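(* Let $n\in\mathbb{N}$ be divisible by $q-1$, with height $h=\mathrm{ht}(n)$. Consider the algorithm $\mathbf{Alg}$ (described in the context) applied to $n$. (i) $\mathbf{Alg}$ terminates at a step $\nu\le\ell_p(n)$, where $\ell_p(n)$ is the sum of the $p$-adic digits of $n$. (ii) The final value of $I(m)$ is $q-1$. (iii) The final values of the variables $m$ and $m'$ are $m=X_h$ and $m'=n-X_h$, where $\mathbf{Sh}(n)=(X_1,\dots,X_h)$ is the Sheats composition of $n$.
   Context: $q=p^f$ is a power of the prime $p$; $\mathbb{N}=\{1,2,\dots\}$, $\mathbb{N}_0=\{0,1,\dots\}$. For $a,b\in\mathbb{N}_0$ with base-$p$ digits $a_j,b_j$, $a<_pb$ means $a_j\le b_j$ for all $j$; $a\prec b$ means $a<_pb$ and $a\equiv b\pmod{q-1}$. The height $\mathrm{ht}(n)$ is the maximal $h$ for which there are pairwise distinct $0=n_0\prec n_1\prec\cdots\prec n_h<_pn$. For $n\in\mathbb{N}$ divisible by $q-1$ and $1\le i\le\mathrm{ht}(n)$, an $i$-composition of $n$ is a tuple $(X_1,\dots,X_i)$ of positive multiples of $q-1$ with $X_1+\dots+X_i=n$ such that there is no carry in base $p$ in this sum. The Sheats composition $\mathbf{Sh}(n)$ is the $h$-composition, $h=\mathrm{ht}(n)$, for which $(X_h,X_{h-1},\dots,X_1)$ is lexicographically maximal among all $h$-compositions of $n$. Indicator function: $\ell(n)$ is the sum of the $q$-adic digits of $n$. For $s\in F=\{0,\dots,f-1\}$, $n^{\sigma_s}$ is obtained by replacing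 each $q$-adic digit $b=\sum_{i\in F}a_ip^i$ ($a_i\in\{0,\dots,p-1\}$) of $n$ by $\sum_{i\in F}a_{(i+s)\bmod f}\,p^i$. Then $I(n)=\min_{s\in F}\ell(n^{\sigma_s})$. Algorithm $\mathbf{Alg}$: write $n=\sum_ja_jp^j$ in base $p$ and regard $n$ as the sum of its $p$-parts $d_1\ge d_2\ge\dots\ge d_{\ell_p(n)}$, listed in decreasing order, each power $p^j$ appearing $a_j$ times. (1) Set $m:=0$, $m':=n$, $\nu:=1$. (2) If $I(m'-d_\nu)\ge(q-1)(h-1)$, then set $m:=m+d_\nu$ and $m':=m'-d_\nu$. (3) If $I(m)<q-1$, then set $\nu:=\nu+1$ and go to (2); otherwise stop and output $m$ and $m'$. *)

theory Defs
  imports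
    "HOL-Computational_Algebra.Primes"
    "HOL-Number_Theory.Cong"
    "HOL-Library.While_Combinator"
begin

text \<open>
  Throughout, the prime power \<open>q = p ^ f\<close> is represented by the two parameters \<open>p\<close> and \<open>f\<close>.
\<close>

definition digit :: "nat \<Rightarrow> nat \<Rightarrow> nat \<Rightarrow> nat" where
  "digit b n j = n div b ^ j mod b"

text \<open>For \<open>b \<ge> 2\<close> the digits of \<open>n\<close> at positions \<open>j > n\<close> vanish, since \<open>b ^ j > n\<close>;
  hence sums over all digits may be truncated to \<open>j \<le> n\<close>.\<close>

definition digit_sum :: "nat \<Rightarrow> nat \<Rightarrow> nat" where
  "digit_sum b n = (\<Sum>j\<le>n. digit b n j)"

definition le_p :: "nat \<Rightarrow> nat \<Rightarrow> nat \<Rightarrow> bool" where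
  "le_p p a b \<longleftrightarrow> (\<forall>j. digit p a j \<le> digit p b j)"

definition prec :: "nat \<Rightarrow> nat \<Rightarrow> nat \<Rightarrow> nat \<Rightarrow> bool" where
  "prec p f a b \<longleftrightarrow> le_p p a b \<and> [a = b] (mod (p ^ f - 1))"

text \<open>The final link \<open>c h\<close> of the chain is only required to lie below \<open>n\<close> digitwise;
  no congruence with \<open>n\<close> is imposed on it.\<close>

definition height :: "nat \<Rightarrow> nat \<Rightarrow> nat \<Rightarrow> nat" where
  "height p f n =
     Max {h. \<exists>c :: nat \<Rightarrow> nat. c 0 = 0 \<and> inj_on c {..h} \<and>
               (\<forall>i<h. prec p f (c i) (c (Suc i))) \<and> le_p p (c h) n}"

text \<open>A tuple \<open>(X\<^sub>1, \<dots>, X\<^sub>i)\<close> is the list \<open>[X\<^sub>1, \<dots>, X\<^sub>i]\<close>. The sum of its entries has no carry in base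
  \<open>p\<close> iff at every position the digits of the entries add up to less than \<open>p\<close>.\<close>

definition no_carry :: "nat \<Rightarrow> nat list \<Rightarrow> bool" where
  "no_carry p Xs \<longleftrightarrow> (\<forall>j. (\<Sum>X\<leftarrow>Xs. digit p X j) < p)"

definition is_composition :: "nat \<Rightarrow> nat \<Rightarrow> nat \<Rightarrow> nat \<Rightarrow> nat list \<Rightarrow> bool" where
  "is_composition p f i n Xs \<longleftrightarrow>
     length Xs = i \<and> (\<forall>X\<in>set Xs. 0 < X \<and> p ^ f - 1 dvd X) \<and>
     sum_list Xs = n \<and> no_carry p Xs"

text \<open>The lexicographic comparison starts with the last entry, hence the reversals.\<close>

definition Sh :: "nat \<Rightarrow> nat \<Rightarrow> nat \<Rightarrow> nat list" where
  "Sh p f n =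
     (THE Xs. is_composition p f (height p f n) n Xs \<and>
        (\<forall>Ys. is_composition p f (height p f n) n Ys \<longrightarrow>
           Ys = Xs \<or> (rev Ys, rev Xs) \<in> lexord less_than))"

definition rotate_digit :: "nat \<Rightarrow> nat \<Rightarrow> nat \<Rightarrow> nat \<Rightarrow> nat" where
  "rotate_digit p f s b = (\<Sum>i<f. digit p b ((i + s) mod f) * p ^ i)"

definition sigma :: "nat \<Rightarrow> nat \<Rightarrow> nat \<Rightarrow> nat \<Rightarrow> nat" where
  "sigma p f s n = (\<Sum>k\<le>n. rotate_digit p f s (digit (p ^ f) n k) * (p ^ f) ^ k)"

definition indicator_I :: "nat \<Rightarrow> nat \<Rightarrow> nat \<Rightarrow> nat" where
  "indicator_I p f n = Min ((\<lambda>s. digit_sum (p ^ f) (sigma p f s n)) ` {..<f})"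

text \<open>The \<open>p\<close>-parts of \<open>n\<close> in decreasing order, each \<open>p ^ j\<close> occurring \<open>digit p n j\<close> times.\<close>

definition p_parts :: "nat \<Rightarrow> nat \<Rightarrow> nat list" where
  "p_parts p n = concat (map (\<lambda>j. replicate (digit p n j) (p ^ j)) (rev [0..<Suc n]))"

text \<open>A state of the algorithm is a triple \<open>(\<nu>, m, m')\<close>. The parts are numbered from \<open>1\<close>,
  whereas list positions start at \<open>0\<close>. The test in step (2) involves the height of the input \<open>n\<close>,
  not that of the current \<open>m'\<close>.\<close>

definition alg_step2 :: "nat \<Rightarrow> nat \<Rightarrow> nat \<Rightarrow> nat \<times> nat \<times> nat \<Rightarrow> nat \<times> nat \<times> nat" where
  "alg_step2 p f n = (\<lambda>(\<nu>, m, m').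
     let d = p_parts p n ! (\<nu> - 1) in
     if indicator_I p f (m' - d) \<ge> (p ^ f - 1) * (height p f n - 1)
     then (\<nu>, m + d, m' - d)
     else (\<nu>, m, m'))"

text \<open>\<open>Alg p f n = Some (\<nu>, m, m')\<close> means that the algorithm stops at step \<open>\<nu>\<close> with output \<open>m\<close>, \<open>m'\<close>;
  \<open>None\<close> means that it never stops. Step (2) is executed once before the first test in step (3).
  The list access in step (2) is only meaningful while \<open>\<nu> \<le> digit_sum p n\<close>; as \<open>\<nu>\<close> never
  decreases, a run stopping at such a \<open>\<nu>\<close> makes no other access.\<close>

definition Alg :: "nat \<Rightarrow> nat \<Rightarrow> nat \<Rightarrow> (nat \<times> nat \<times> nat) option" where
  "Alg p f n =
     while_option
       (\<lambda>(\<nu>, m, m'). indicator_I p f m < p ^ f - 1)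
       (\<lambda>(\<nu>, m, m'). alg_step2 p f n (\<nu> + 1, m, m'))
       (alg_step2 p f n (1, 0, n))"

end

theory Submission
  imports Defs
begin

text \<open>
  Write \<open>q = p ^ f\<close>. Rotating the digits inside every \<open>q\<close>-adic digit replaces the part \<open>p ^ j\<close> by one
  of \<open>q\<close>-adic weight \<open>p ^ ((j + s) mod f)\<close>. Thus \<open>I n\<close> is the minimum over \<open>s\<close> of the rotated weights
  \<open>wt s n\<close>, which are additive on carry-free sums and satisfy the cyclic recurrence
  \<open>p * wt s n = wt (s + 1) n + (q - 1) * wc s n\<close>, where \<open>wc s n\<close> counts the parts of \<open>n\<close> whose
  exponent wraps around. If \<open>q - 1\<close> divides \<open>n\<close>, then it divides all rotated weights, so these are
  \<open>(q - 1) * u s\<close> for integers \<open>u s\<close>; conversely the cyclic vector \<open>u\<close> determines the counts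
  \<open>p * u s - u (s + 1)\<close>.

  The heart of the proof is the extension lemma \<open>extend_to_multiple\<close>. Let \<open>n\<close> be a multiple of \<open>q - 1\<close>
  and let \<open>Y\<close> be a subnumber of \<open>n\<close> (digitwise below \<open>n\<close>) such that all rotated weights of \<open>n - Y\<close> are at
  least \<open>(q - 1) * k\<close>. Then \<open>Y\<close> can be enlarged to a multiple of \<open>q - 1\<close> below \<open>n\<close> without violating
  this bound. In terms of the vectors \<open>u\<close>, each \<open>u (s + 1)\<close> is confined to an interval depending on
  \<open>u s\<close>; taking its largest element is a monotone choice, so going once around the cycle has a fixed
  point, which is the required vector.

  Three facts follow. Splitting off one part at a time and extending it yields compositions, and hence
  \<open>ht n = I n / (q - 1)\<close> (\<open>Q_mult_height\<close>). Next, let \<open>G\<close> (\<open>top_part n\<close>) be the numerically largest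
  subnumber of \<open>n\<close> with \<open>I (n - G) \<ge> (q - 1) * (ht n - 1)\<close>. As \<open>G\<close> can be extended, it is itself a multiple of
  \<open>q - 1\<close>; so it ends a composition of maximal length, and it is the last entry of the Sheats
  composition (\<open>last_Sh\<close>). Finally \<open>I n = (q - 1) * ht n\<close> leaves \<open>G\<close> at most the weight \<open>q - 1\<close> in the
  rotation where \<open>n\<close> has its minimum, so \<open>I G = q - 1\<close>, and no proper subnumber of \<open>G\<close> reaches this
  value.

  The subnumbers admitted by the test of the algorithm are closed under removing parts. Greedy
  selection in decreasing order therefore builds up exactly \<open>G\<close>: accepting a part that is not in \<open>G\<close>
  would give an admitted number larger than \<open>G\<close>. The stopping criterion holds at the moment when \<open>G\<close>
  is complete, and not before.
\<close>

section \<open>Digits\<close>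

lemma digit_0: "digit b n 0 = n mod b"
  by (simp add: digit_def)

lemma digit_Suc: "digit b n (Suc j) = digit b (n div b) j"
  by (simp add: digit_def div_mult2_eq)

lemma digit_less: "0 < b \<Longrightarrow> digit b n j < b"
  by (simp add: digit_def)

lemma less_power_of_le:
  assumes "2 \<le> (b::nat)" "n \<le> k"
  shows "n < b ^ k"
proof -
  have "n < 2 ^ n" by simp
  also have "(2::nat) ^ n \<le> 2 ^ k" using assms(2) by simp
  also have "(2::nat) ^ k \<le> b ^ k" using assms(1) by (rule power_mono) simp
  finally show ?thesis .
qed

lemma digit_eq_0:
  assumes "2 \<le> b" "n \<le> j"
  shows "digit b n j = 0"
  using less_power_of_le[OF assms] by (simp add: digit_def)

lemma digit_pos_imp_le: "2 \<le> b \<Longrightarrow> 0 < digit b n j \<Longrightarrow> j \<le> n"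
  using digit_eq_0[of b n j] by linarith

lemma digit_zero [simp]: "digit b 0 j = 0"
  by (simp add: digit_def)

lemma sum_digits:
  assumes "0 < b" "n < b ^ k"
  shows "(\<Sum>j<k. digit b n j * b ^ j) = n"
  using assms(2)
proof (induction k arbitrary: n)
  case 0
  then show ?case by simp
next
  case (Suc k)
  have "n div b < b ^ k"
    using Suc.prems assms(1) by (simp add: less_mult_imp_div_less mult.commute)
  then have IH: "(\<Sum>j<k. digit b (n div b) j * b ^ j) = n div b"
    by (rule Suc.IH)
  have "(\<Sum>j<Suc k. digit b n j * b ^ j)
      = n mod b + b * (\<Sum>j<k. digit b (n div b) j * b ^ j)"
    by (subst sum.lessThan_Suc_shift)
       (simp add: digit_0 digit_Suc sum_distrib_left mult.left_commute mult.assoc)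
  then show ?case by (simp add: IH)
qed

lemma digit_of_sum:
  assumes "\<And>j. j < k \<Longrightarrow> a j < b"
  shows "digit b (\<Sum>j<k. a j * b ^ j) i = (if i < k then a i else 0)"
  using assms
proof (induction k arbitrary: a i)
  case 0
  then show ?case by simp
next
  case (Suc k)
  define r where "r = (\<Sum>j<k. a (Suc j) * b ^ j)"
  have split: "(\<Sum>j<Suc k. a j * b ^ j) = a 0 + b * r"
    unfolding r_def
    by (subst sum.lessThan_Suc_shift)
       (simp add: sum_distrib_left mult.left_commute mult.assoc)
  have a0: "a 0 < b" using Suc.prems by simp
  have IH: "digit b r i' = (if i' < k then a (Suc i') else 0)" for i'
    unfolding r_def by (rule Suc.IH) (simp add: Suc.prems)
  show ?case
    unfolding split using a0 IH by (cases i) (simp_all add: digit_0 digit_Suc)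
qed

lemma digit_eqI:
  assumes "2 \<le> b" "\<And>j. digit b m j = digit b n j"
  shows "m = n"
proof -
  have b: "0 < b" using assms(1) by simp
  have "m = (\<Sum>j<m + n. digit b m j * b ^ j)"
    by (rule sum_digits[OF b less_power_of_le[OF assms(1)], symmetric]) simp
  also have "\<dots> = (\<Sum>j<m + n. digit b n j * b ^ j)"
    by (simp only: assms(2))
  also have "\<dots> = n"
    by (rule sum_digits[OF b less_power_of_le[OF assms(1)]]) simp
  finally show ?thesis .
qed

lemma digit_add:
  assumes "2 \<le> b" "\<And>j. digit b m j + digit b n j < b"
  shows "digit b (m + n) j = digit b m j + digit b n j"
proof -
  have b: "0 < b" using assms(1) by simp
  define k where "k = Suc (m + n + j)"
  have "(\<Sum>i<k. digit b m i * b ^ i) = m" "(\<Sum>i<k. digit b n i * b ^ i) = n"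
    by (rule sum_digits[OF b less_power_of_le[OF assms(1)]], simp add: k_def)+
  then have sum: "(\<Sum>i<k. (digit b m i + digit b n i) * b ^ i) = m + n"
    by (simp only: add_mult_distrib sum.distrib)
  have "digit b (\<Sum>i<k. (digit b m i + digit b n i) * b ^ i) j
      = (if j < k then digit b m j + digit b n j else 0)"
    by (rule digit_of_sum) (rule assms(2))
  then show ?thesis
    by (simp only: sum) (simp add: k_def)
qed

lemma digit_base_power:
  assumes "2 \<le> b"
  shows "digit b (b ^ j) i = (if i = j then 1 else 0)"
proof -
  have "(\<Sum>i<Suc j. (if i = j then 1 else 0) * b ^ i) = b ^ j"
    by simp
  then show ?thesis
    using digit_of_sum[of "Suc j" "\<lambda>i. if i = j then 1 else 0" b i] assms by auto
qed

lemma digit_shift: "digit b (n div b ^ j) i = digit b n (j + i)"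
  by (simp add: digit_def div_mult2_eq power_add)

lemma digit_of_digit:
  assumes "0 < b" "r < f"
  shows "digit b (digit (b ^ f) n k) r = digit b n (k * f + r)"
proof -
  define m where "m = n div b ^ (k * f)"
  have "digit (b ^ f) n k = m mod b ^ f"
    by (simp add: digit_def m_def power_mult mult.commute)
  moreover have "digit b (m mod b ^ f) r = digit b m r"
  proof -
    have e: "b ^ f = b ^ r * b ^ (f - r)"
      using assms(2) by (simp flip: power_add)
    have "b dvd b ^ (f - r)" using assms(2) by (simp add: dvd_power)
    moreover have "m mod b ^ f div b ^ r = m div b ^ r mod b ^ (f - r)"
      using assms(1) by (simp add: e mod_mult2_eq)
    ultimately show ?thesis by (simp add: digit_def mod_mod_cancel)
  qed
  ultimately show ?thesis by (simp add: m_def digit_shift)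
qed

text \<open>This bound makes a subnumber obtained by accepting the part \<open>b ^ j\<close> numerically larger than
  every number with the same digits from position \<open>j\<close> on.\<close>

lemma less_add_power_if_digits_agree:
  assumes "2 \<le> b" "\<And>i. j \<le> i \<Longrightarrow> digit b m i = digit b n i"
  shows "n < m + b ^ j"
proof -
  have "m div b ^ j = n div b ^ j"
    by (rule digit_eqI[OF assms(1)]) (simp add: digit_shift assms(2))
  then have "n = m div b ^ j * b ^ j + n mod b ^ j" by (metis div_mult_mod_eq)
  also have "\<dots> < m div b ^ j * b ^ j + b ^ j" using assms(1) by simp
  also have "\<dots> \<le> m + b ^ j" by simp
  finally show ?thesis .
qed

lemma le_p_refl [simp]: "le_p p n n"
  by (simp add: le_p_def)

lemma le_p_trans: "le_p p a b \<Longrightarrow> le_p p b c \<Longrightarrow> le_p p a c"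
  unfolding le_p_def by (meson order_trans)

text \<open>The number whose digits are the digitwise differences adds up with \<open>a\<close> to \<open>n\<close>, so it is
  \<open>n - a\<close>: no borrowing takes place.\<close>

lemma digit_diff_and_le:
  assumes "2 \<le> p" "le_p p a n"
  shows "(\<forall>j. digit p (n - a) j = digit p n j - digit p a j) \<and> a \<le> n"
proof -
  have p: "0 < p" using assms(1) by simp
  have le: "digit p a j \<le> digit p n j" for j
    using assms(2) by (simp add: le_p_def)
  define k where "k = a + n"
  define c where "c = (\<Sum>j<k. (digit p n j - digit p a j) * p ^ j)"
  have sums: "(\<Sum>j<k. digit p a j * p ^ j) = a" "(\<Sum>j<k. digit p n j * p ^ j) = n"
    by (rule sum_digits[OF p less_power_of_le[OF assms(1)]], simp add: k_def)+
  have "(\<Sum>j<k. digit p a j * p ^ j) + c = (\<Sum>j<k. digit p n j * p ^ j)"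
  proof -
    have "digit p a j * p ^ j + (digit p n j - digit p a j) * p ^ j = digit p n j * p ^ j" for j
      using le[of j] by (metis add_mult_distrib le_add_diff_inverse)
    then show ?thesis by (simp only: c_def sum.distrib[symmetric])
  qed
  then have "a + c = n" by (simp only: sums)
  then have "n - a = c" "a \<le> n" by auto
  moreover have "digit p c j = digit p n j - digit p a j" for j
  proof -
    have "digit p n i - digit p a i < p" for i
      using digit_less[OF p, of n i] by linarith
    then have "digit p c j = (if j < k then digit p n j - digit p a j else 0)"
      unfolding c_def by (intro digit_of_sum)
    then show ?thesis
      using digit_eq_0[OF assms(1), of n j] by (simp add: k_def)
  qed
  ultimately show ?thesis by simp
qed

lemmas digit_diff = digit_diff_and_le[THEN conjunct1, rule_format]
lemmas le_p_imp_le = digit_diff_and_le[THEN conjunct2]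

lemma le_p_antimono_diff:
  assumes "2 \<le> p" "le_p p a b" "le_p p b n"
  shows "le_p p (n - b) (n - a)"
  using assms le_p_trans[OF assms(2,3)]
  by (auto simp: digit_diff le_p_def intro: diff_le_mono2)

lemma le_p_add_power:
  assumes "2 \<le> p" "le_p p m n" "digit p m j < digit p n j"
  shows "digit p (m + p ^ j) i = digit p m i + (if i = j then 1 else 0)"
    and "le_p p (m + p ^ j) n"
proof -
  have p: "0 < p" using assms(1) by simp
  have *: "digit p (m + p ^ j) i = digit p m i + digit p (p ^ j) i" for i
  proof (rule digit_add[OF assms(1)])
    fix i
    show "digit p m i + digit p (p ^ j) i < p"
      using digit_less[OF p, of m i] digit_less[OF p, of n j] assms(3)
      by (simp add: digit_base_power[OF assms(1)])
  qed
  then show "digit p (m + p ^ j) i = digit p m i + (if i = j then 1 else 0)"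
    by (simp add: digit_base_power[OF assms(1)])
  show "le_p p (m + p ^ j) n"
    using assms(2,3) by (auto simp: le_p_def * digit_base_power[OF assms(1)])
qed

lemma exists_digit_pos:
  assumes "2 \<le> b" "0 < n"
  shows "\<exists>j. 0 < digit b n j"
proof (rule ccontr)
  assume "\<not> ?thesis"
  then have "n = 0" by - (rule digit_eqI[OF assms(1)], simp)
  then show False using assms(2) by simp
qed

lemma digit_sum_list:
  assumes "2 \<le> p" "no_carry p Xs"
  shows "digit p (sum_list Xs) j = (\<Sum>X\<leftarrow>Xs. digit p X j)"
  using assms(2)
proof (induction Xs arbitrary: j)
  case Nil
  then show ?case by simp
next
  case (Cons X Xs)
  have nc: "digit p X i + (\<Sum>X\<leftarrow>Xs. digit p X i) < p" for i
    using Cons.prems by (simp add: no_carry_def)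
  then have "no_carry p Xs"
    unfolding no_carry_def using add_lessD1 by (metis add.commute)
  then have IH: "digit p (sum_list Xs) i = (\<Sum>X\<leftarrow>Xs. digit p X i)" for i
    by (rule Cons.IH)
  show ?case
    using digit_add[OF assms(1), of X "sum_list Xs" j] nc IH by simp
qed

lemma digit_sum_eq:
  assumes "2 \<le> b" "n \<le> K"
  shows "digit_sum b n = (\<Sum>j\<le>K. digit b n j)"
  unfolding digit_sum_def
  by (rule sum.mono_neutral_left) (use assms in \<open>auto simp: digit_eq_0\<close>)

lemma no_carry_append: "no_carry p (Xs @ Ys) \<Longrightarrow> no_carry p Xs \<and> no_carry p Ys"
proof -
  assume nc: "no_carry p (Xs @ Ys)"
  have "(\<Sum>X\<leftarrow>Xs. digit p X j) < p \<and> (\<Sum>X\<leftarrow>Ys. digit p X j) < p" for j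
    using nc unfolding no_carry_def map_append sum_list_append
    by (meson le_add1 le_add2 le_less_trans)
  then show ?thesis by (simp add: no_carry_def)
qed

lemma le_p_sum_list_append:
  assumes "2 \<le> p" "no_carry p (Xs @ Ys)"
  shows "le_p p (sum_list Xs) (sum_list (Xs @ Ys))" "le_p p (sum_list Ys) (sum_list (Xs @ Ys))"
  using digit_sum_list[OF assms] no_carry_append[OF assms(2)] digit_sum_list[OF assms(1)]
  by (simp_all add: le_p_def del: sum_list_append) (simp_all add: sum_list_append)

section \<open>Rotated weights\<close>

text \<open>The parameter \<open>s\<close> may be any natural number and matters only modulo \<open>f\<close>. For \<open>s < f\<close> the weight
  with parameter \<open>f - s\<close> is the \<open>q\<close>-adic digit sum of \<open>n\<^sup>\<sigma>\<close> for \<open>\<sigma> = \<sigma>\<^sub>s\<close>.\<close>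

definition weight :: "nat \<Rightarrow> nat \<Rightarrow> nat \<Rightarrow> nat \<Rightarrow> nat" where
  "weight p f s n = (\<Sum>j\<le>n. digit p n j * p ^ ((j + s) mod f))"

text \<open>The parts that go from weight \<open>p ^ (f - 1)\<close> to weight \<open>1\<close> when \<open>s\<close> is increased by \<open>1\<close>. For \<open>s < f\<close>
  the position sets run once through the residue classes modulo \<open>f\<close>.\<close>

definition wrap_count :: "nat \<Rightarrow> nat \<Rightarrow> nat \<Rightarrow> nat \<Rightarrow> nat" where
  "wrap_count p f s n = (\<Sum>j | j \<le> n \<and> (j + s) mod f = f - 1. digit p n j)"

lemma exists_between_with_sum:
  fixes lo hi :: "'a \<Rightarrow> nat"
  assumes "finite J" "\<And>j. j \<in> J \<Longrightarrow> lo j \<le> hi j" "sum lo J \<le> t" "t \<le> sum hi J"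
  shows "\<exists>x. (\<forall>j\<in>J. lo j \<le> x j \<and> x j \<le> hi j) \<and> sum x J = t"
  using assms
proof (induction J arbitrary: t rule: finite_induct)
  case empty
  then show ?case by simp
next
  case (insert a J)
  define v where "v = min (hi a) (t - sum lo J)"
  have "lo a \<le> hi a" using insert.prems(1) by simp
  moreover have "lo a + sum lo J \<le> t" "t \<le> hi a + sum hi J"
    using insert.hyps insert.prems by auto
  moreover have "sum lo J \<le> sum hi J" using insert.prems(1) by (auto intro: sum_mono)
  ultimately have v: "lo a \<le> v" "v \<le> hi a" "sum lo J \<le> t - v" "t - v \<le> sum hi J" "v \<le> t"
    by (auto simp: v_def)
  obtain x where x: "\<forall>j\<in>J. lo j \<le> x j \<and> x j \<le> hi j" "sum x J = t - v"
    using insert.IH[OF _ v(3,4)] insert.prems(1) by auto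
  have "sum (x(a := v)) J = sum x J"
    using insert.hyps(2) by (intro sum.cong) auto
  then have "sum (x(a := v)) (insert a J) = t"
    using insert.hyps v(5) x(2) by simp
  then show ?case using x(1) v(1,2) by (intro exI[of _ "x(a := v)"]) auto
qed

text \<open>The least \<open>z\<close> in \<open>P\<close> with \<open>\<phi> z \<le> z\<close> is fixed, since monotonicity carries this property over to
  \<open>\<phi> z\<close>.\<close>

lemma exists_fixed_point_le:
  fixes \<phi> :: "nat \<Rightarrow> nat"
  assumes "mono \<phi>" "\<phi> B \<le> B" "P B" "\<And>z. P z \<Longrightarrow> P (\<phi> z)"
  shows "\<exists>z. P z \<and> \<phi> z = z"
proof -
  define z where "z = (LEAST z. P z \<and> \<phi> z \<le> z)"
  have z: "P z \<and> \<phi> z \<le> z"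
    unfolding z_def by (rule LeastI[of _ B]) (use assms in simp)
  moreover have "z \<le> \<phi> z"
    unfolding z_def
    by (rule Least_le) (use z assms(1,4) in \<open>auto simp: z_def[symmetric] dest: monoD\<close>)
  ultimately show ?thesis by auto
qed

lemma exists_greatest_of_finite:
  assumes "finite A" "A \<noteq> {}" "trans r" "\<And>x y. x = y \<or> (x, y) \<in> r \<or> (y, x) \<in> r"
  shows "\<exists>x\<in>A. \<forall>y\<in>A. y = x \<or> (y, x) \<in> r"
  using assms(1,2)
proof (induction A rule: finite_ne_induct)
  case (insert a A)
  then obtain x where x: "x \<in> A" "\<forall>y\<in>A. y = x \<or> (y, x) \<in> r" by blast
  show ?case
  proof (cases "(x, a) \<in> r")
    case True
    then have "\<forall>y\<in>insert a A. y = a \<or> (y, a) \<in> r"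
      using x(2) transD[OF assms(3)] by (metis insert_iff)
    then show ?thesis by blast
  next
    case False
    then show ?thesis using x assms(4)[of x a] by blast
  qed
qed simp

lemma p_parts_power: "d \<in> set (p_parts p n) \<Longrightarrow> \<exists>j. d = p ^ j"
  by (auto simp: p_parts_def)

lemma p_parts_length: "length (p_parts p n) = digit_sum p n"
proof -
  have "length (concat (map (\<lambda>j. replicate (digit p n j) (p ^ j)) (rev [0..<k])))
      = (\<Sum>j<k. digit p n j)" for k
    by (induction k) simp_all
  then show ?thesis by (simp add: p_parts_def digit_sum_def lessThan_Suc_atMost del: upt_Suc)
qed

lemma count_list_replicate: "count_list (replicate k x) y = (if x = y then k else 0)"
  by (induction k) auto

lemma p_parts_count:
  assumes "2 \<le> p"
  shows "count_list (p_parts p n) (p ^ i) = digit p n i"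
proof -
  have "count_list (concat (map (\<lambda>j. replicate (digit p n j) (p ^ j)) (rev [0..<k]))) (p ^ i)
      = (if i < k then digit p n i else 0)" for k
    using assms by (induction k) (auto simp: count_list_replicate less_Suc_eq)
  from this[of "Suc n"] show ?thesis
    using digit_eq_0[OF assms, of n i] by (simp add: p_parts_def del: upt_Suc)
qed

lemma p_parts_sorted:
  assumes "2 \<le> p"
  shows "sorted_wrt (\<ge>) (p_parts p n)"
proof -
  have "sorted_wrt (\<ge>) (concat (map (\<lambda>j. replicate (digit p n j) (p ^ j)) (rev [0..<k])))" for k
  proof (induction k)
    case (Suc k)
    have "sorted_wrt (\<ge>) (replicate c x)" for c and x :: nat
      by (induction c) auto
    moreover have "p ^ j \<le> p ^ k" if "j < k" for j
      using that assms by (intro power_increasing) auto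
    ultimately show ?case using Suc.IH by (auto simp: sorted_wrt_append)
  qed simp
  then show ?thesis by (simp only: p_parts_def)
qed

locale base_and_period =
  fixes p f Q :: nat
  assumes p: "2 \<le> p" and f: "1 \<le> f" and Q_eq: "Q = p ^ f - 1"
begin

abbreviation dg where "dg \<equiv> digit p"
abbreviation wt where "wt \<equiv> weight p f"
abbreviation wc where "wc \<equiv> wrap_count p f"
abbreviation I where "I \<equiv> indicator_I p f"

lemma q_ge_2: "2 \<le> p ^ f"
  using less_power_of_le[OF p f] by simp

lemma Q_pos: "0 < Q"
  using q_ge_2 Q_eq by linarith

lemma power_eq_Suc_Q: "p ^ f = Suc Q"
  using q_ge_2 Q_eq by linarith

lemma weight_bound: "n \<le> K \<Longrightarrow> wt s n = (\<Sum>j\<le>K. dg n j * p ^ ((j + s) mod f))"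
  unfolding weight_def
  by (rule sum.mono_neutral_left) (auto dest: digit_pos_imp_le[OF p])

lemma wrap_count_bound:
  "n \<le> K \<Longrightarrow> wc s n = (\<Sum>j | j \<le> K \<and> (j + s) mod f = f - 1. dg n j)"
  unfolding wrap_count_def
  by (rule sum.mono_neutral_left) (auto dest: digit_pos_imp_le[OF p])

lemma weight_mod: "wt (s mod f) n = wt s n"
  by (simp add: weight_def mod_add_right_eq)

lemma weight_zero [simp]: "wt s 0 = 0"
  by (simp add: weight_def)

lemma weight_diff:
  assumes "le_p p a n"
  shows "wt s n = wt s a + wt s (n - a)"
proof -
  have "a \<le> n" by (rule le_p_imp_le[OF p assms])
  moreover have "dg n j = dg a j + dg (n - a) j" for j
    using assms by (simp add: digit_diff[OF p assms] le_p_def)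
  ultimately show ?thesis
    by (simp add: weight_bound[of _ n] add_mult_distrib flip: sum.distrib)
qed

lemma weight_mono: "le_p p a n \<Longrightarrow> wt s a \<le> wt s n"
  by (simp add: weight_diff)

lemma weight_eq_0_iff: "wt s n = 0 \<longleftrightarrow> n = 0"
proof
  assume "wt s n = 0"
  then have "dg n j = 0" if "j \<le> n" for j
    using that p by (auto simp: weight_def)
  then have "dg n j = dg 0 j" for j
    using digit_eq_0[OF p, of n j] by (cases "j \<le> n") auto
  then show "n = 0" by (rule digit_eqI[OF p])
qed simp

lemma eq_if_le_p_if_weight_eq:
  assumes "le_p p a n" "wt s n \<le> wt s a"
  shows "a = n"
proof -
  have "wt s (n - a) = 0" using weight_diff[OF assms(1), of s] assms(2) by simp
  then show ?thesis using le_p_imp_le[OF p assms(1)] by (simp add: weight_eq_0_iff)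
qed

lemma weight_power: "wt s (p ^ j) = p ^ ((j + s) mod f)"
proof -
  have "j \<le> p ^ j" using less_power_of_le[OF p, of j j] by simp
  then show ?thesis
    by (simp add: weight_def digit_base_power[OF p] if_distrib[of "\<lambda>x. x * _"] cong: if_cong)
qed

lemma weight_power_le: "wt s (p ^ j) \<le> Q"
proof -
  have "(j + s) mod f < f" using f by simp
  then have "p ^ ((j + s) mod f) < p ^ f" using p by (simp add: power_strict_increasing)
  then show ?thesis by (simp add: weight_power power_eq_Suc_Q)
qed

text \<open>Multiplication by \<open>p\<close> raises each exponent by \<open>1\<close>; where the exponent wraps around, \<open>p ^ f\<close>
  exceeds the new weight \<open>1\<close> by \<open>q - 1\<close>.\<close>

lemma weight_Suc: "p * wt s n = wt (Suc s) n + Q * wc s n"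
proof -
  have *: "p * p ^ ((j + s) mod f)
      = p ^ ((j + Suc s) mod f) + (if (j + s) mod f = f - 1 then Q else 0)" for j
  proof (cases "(j + s) mod f = f - 1")
    case True
    then have "Suc ((j + s) mod f) = f" using f by simp
    then have "(j + Suc s) mod f = 0" by (simp add: mod_Suc)
    moreover have "p * p ^ (f - 1) = p ^ f" using f by (simp flip: power_Suc)
    ultimately show ?thesis using True power_eq_Suc_Q by simp
  next
    case False
    then have "(j + Suc s) mod f = Suc ((j + s) mod f)" using f by (simp add: mod_Suc)
    then show ?thesis using False by simp
  qed
  have "p * wt s n = (\<Sum>j\<le>n. dg n j * (p * p ^ ((j + s) mod f)))"
    by (simp add: weight_def sum_distrib_left mult.left_commute)
  also have "\<dots> = wt (Suc s) n
      + (\<Sum>j\<le>n. if (j + s) mod f = f - 1 then Q * dg n j else 0)"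
    unfolding * weight_def
    by (simp add: distrib_left sum.distrib if_distrib[of "\<lambda>x. _ * x"] mult.commute cong: if_cong)
  also have "(\<Sum>j\<le>n. if (j + s) mod f = f - 1 then Q * dg n j else 0) = Q * wc s n"
    by (simp add: wrap_count_def sum_distrib_left sum.If_cases Collect_conj_eq atMost_def)
  finally show ?thesis .
qed

lemma cong_weight_0: "[wt 0 n = n] (mod Q)"
proof -
  have q1: "[p ^ f = 1] (mod Q)"
    unfolding power_eq_Suc_Q cong_def using mod_add_self1[of Q 1] by simp
  have *: "[p ^ (j mod f) = p ^ j] (mod Q)" for j
  proof -
    have "[(p ^ f) ^ (j div f) * p ^ (j mod f) = 1 ^ (j div f) * p ^ (j mod f)] (mod Q)"
      by (intro cong_mult cong_pow q1 cong_refl)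
    moreover have "(p ^ f) ^ (j div f) * p ^ (j mod f) = p ^ j"
      by (simp flip: power_mult power_add)
    ultimately show ?thesis by (simp add: cong_sym)
  qed
  have "[wt 0 n = (\<Sum>j\<le>n. dg n j * p ^ j)] (mod Q)"
    unfolding weight_def by (intro cong_sum cong_mult cong_refl) (simp only: add_0_right *)
  moreover have "(\<Sum>j<Suc n. dg n j * p ^ j) = n"
    using p by (intro sum_digits less_power_of_le) auto
  ultimately show ?thesis by (simp add: lessThan_Suc_atMost)
qed

lemma dvd_iff_dvd_weight_0: "Q dvd n \<longleftrightarrow> Q dvd wt 0 n"
  using cong_weight_0 by (metis cong_dvd_iff)

lemma dvd_weight: "Q dvd n \<Longrightarrow> Q dvd wt s n"
proof (induction s)
  case 0
  then show ?case using dvd_iff_dvd_weight_0 by blast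
next
  case (Suc s)
  then have "Q dvd wt (Suc s) n + Q * wc s n" by (simp flip: weight_Suc)
  then show ?case by (metis dvd_add_left_iff dvd_triv_left)
qed

lemma Q_le_weight: "Q dvd n \<Longrightarrow> 0 < n \<Longrightarrow> Q \<le> wt s n"
  using dvd_weight[of n s] weight_eq_0_iff[of s n] by (metis dvd_imp_le gr0I less_irrefl)

text \<open>In \<open>n\<^sup>\<sigma>\<close> for \<open>\<sigma> = \<sigma>\<^sub>s\<close>, the \<open>p\<close>-adic digit of \<open>n\<close> at a position congruent to \<open>r\<close> modulo \<open>f\<close> moves to
  exponent \<open>(r - s) mod f\<close> inside its \<open>q\<close>-adic digit. The latter stays below \<open>q\<close>, so that the sum
  defining \<open>sigma\<close> displays the \<open>q\<close>-adic digits.\<close>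

lemma digit_sum_sigma:
  assumes "s < f"
  shows "digit_sum (p ^ f) (sigma p f s n) = wt (f - s) n"
proof -
  let ?q = "p ^ f" and ?r = "\<lambda>k. rotate_digit p f s (digit (p ^ f) n k)"
  have r_less: "?r k < ?q" for k
  proof -
    define b where "b = digit ?q n k"
    define R where "R = (\<Sum>i<f. dg b ((i + s) mod f) * p ^ i)"
    have dR: "dg R i = (if i < f then dg b ((i + s) mod f) else 0)" for i
      unfolding R_def using p by (intro digit_of_sum digit_less) simp
    have "R div p ^ f = 0"
      by (rule digit_eqI[OF p]) (simp add: digit_shift dR)
    then have "R < p ^ f" using p by (simp add: div_eq_0_iff)
    then show ?thesis by (simp add: rotate_digit_def R_def b_def)
  qed
  have sig: "sigma p f s n = (\<Sum>k<Suc n. ?r k * ?q ^ k)"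
    by (simp add: sigma_def lessThan_Suc_atMost)
  have dsig: "digit ?q (sigma p f s n) k = (if k < Suc n then ?r k else 0)" for k
    unfolding sig by (rule digit_of_sum) (rule r_less)
  have "digit_sum ?q (sigma p f s n)
      = (\<Sum>k\<le>sigma p f s n + n. digit ?q (sigma p f s n) k)"
    by (rule digit_sum_eq[OF q_ge_2]) simp
  also have "\<dots> = (\<Sum>k<Suc n. ?r k)"
    unfolding dsig by (rule sum.mono_neutral_cong_right) auto
  also have "\<dots> = (\<Sum>k<Suc n. \<Sum>j = k * f..<k * f + f. dg n j * p ^ ((j + (f - s)) mod f))"
  proof (rule sum.cong[OF refl])
    fix k
    have "?r k = (\<Sum>i<f. dg n (k * f + (i + s) mod f) * p ^ i)"
      unfolding rotate_digit_def using p f by (simp add: digit_of_digit)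
    also have "\<dots> = (\<Sum>j = k * f..<k * f + f. dg n j * p ^ ((j + (f - s)) mod f))"
    proof (rule sum.reindex_bij_witness[where
          i = "\<lambda>j. (j + (f - s)) mod f" and j = "\<lambda>i. k * f + (i + s) mod f"])
      fix i assume i: "i \<in> {..<f}"
      have "(k * f + (i + s) mod f + (f - s)) mod f = ((i + s) mod f + (f - s)) mod f"
        by (simp add: add.assoc)
      also have "\<dots> = (i + s + (f - s)) mod f" by (rule mod_add_left_eq)
      also have "\<dots> = i" using i assms by simp
      finally show rot: "(k * f + (i + s) mod f + (f - s)) mod f = i" .
      show "k * f + (i + s) mod f \<in> {k * f..<k * f + f}" using f by simp
      show "dg n (k * f + (i + s) mod f) * p ^ ((k * f + (i + s) mod f + (f - s)) mod f)
          = dg n (k * f + (i + s) mod f) * p ^ i"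
        by (simp only: rot)
    next
      fix j assume j: "j \<in> {k * f..<k * f + f}"
      define t where "t = j - k * f"
      have t: "j = k * f + t" "t < f" using j by (auto simp: t_def)
      have "((j + (f - s)) mod f + s) mod f = (j + (f - s) + s) mod f"
        by (rule mod_add_left_eq)
      also have "\<dots> = t" using t assms by simp
      finally show "k * f + ((j + (f - s)) mod f + s) mod f = j" using t by simp
      show "(j + (f - s)) mod f \<in> {..<f}" using f by simp
    qed
    finally show "?r k = (\<Sum>j = k * f..<k * f + f. dg n j * p ^ ((j + (f - s)) mod f))" .
  qed
  also have "\<dots> = (\<Sum>j<Suc n * f. dg n j * p ^ ((j + (f - s)) mod f))"
    by (rule sum.nat_group)
  also have "\<dots> = wt (f - s) n"
  proof -
    have "Suc n \<le> Suc n * f" using mult_le_mono2[OF f, of "Suc n"] by simp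
    then show ?thesis
      unfolding weight_def
      by (intro sum.mono_neutral_right) (auto dest: digit_pos_imp_le[OF p])
  qed
  finally show ?thesis .
qed

lemma indicator_eq: "I n = Min ((\<lambda>s. wt (f - s) n) ` {..<f})"
  unfolding indicator_I_def by (simp add: digit_sum_sigma cong: image_cong_simp)

lemma indicator_le_weight: "I n \<le> wt s n"
proof -
  define t where "t = (f - s mod f) mod f"
  have t: "t < f" using f by (simp add: t_def)
  have sf: "s mod f < f" using f by simp
  have "(f - t) mod f = s mod f"
  proof (cases "s mod f = 0")
    case False
    then have "t = f - s mod f" using f unfolding t_def by (intro mod_less) simp
    then show ?thesis using sf f by (simp add: mod_less)
  qed (simp add: t_def)
  then have "wt (f - t) n = wt s n" by (metis weight_mod)
  moreover have "wt (f - t) n \<in> (\<lambda>s. wt (f - s) n) ` {..<f}" using t by blast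
  ultimately show ?thesis unfolding indicator_eq by (metis Min_le finite_imageI finite_lessThan)
qed

lemma indicator_attained: "\<exists>s. I n = wt s n"
proof -
  have "0 \<in> {..<f}" using f by simp
  then have "{..<f} \<noteq> {}" by blast
  then have "I n \<in> (\<lambda>s. wt (f - s) n) ` {..<f}"
    unfolding indicator_eq by (intro Min_in) auto
  then show ?thesis by auto
qed

lemma le_indicator_iff: "c \<le> I n \<longleftrightarrow> (\<forall>s. c \<le> wt s n)"
  using indicator_le_weight indicator_attained by (metis order_trans)

lemma wrap_count_mono:
  assumes "le_p p a n"
  shows "wc s a \<le> wc s n"
  using assms le_p_imp_le[OF p assms]
  by (auto simp: wrap_count_bound[of _ n] le_p_def intro!: sum_mono)

section \<open>Extending a subnumber to a multiple of q - 1\<close>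

text \<open>The wrap counts for \<open>s < f\<close> concern disjoint sets of positions, so the digits of \<open>X\<close> can be
  chosen separately for each \<open>s\<close>.\<close>

lemma exists_with_wrap_counts:
  assumes Y: "le_p p Y n" and x: "\<And>s. s < f \<Longrightarrow> wc s Y \<le> x s \<and> x s \<le> wc s n"
  shows "\<exists>X. le_p p Y X \<and> le_p p X n \<and> (\<forall>s<f. wc s X = x s)"
proof -
  define J where "J s = {j. j \<le> n \<and> (j + s) mod f = f - 1}" for s
  have fin: "finite (J s)" for s
    by (rule finite_subset[of _ "{..n}"]) (auto simp: J_def)
  have wcJ: "wc s a = sum (dg a) (J s)" if "a \<le> n" for s a
    using that by (simp add: wrap_count_bound J_def)
  have Yn: "Y \<le> n" by (rule le_p_imp_le[OF p Y])
  have "\<exists>g. (\<forall>j\<in>J s. dg Y j \<le> g j \<and> g j \<le> dg n j) \<and> sum g (J s) = x s" if "s < f" for s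
    using x[OF that] Y
    by (intro exists_between_with_sum fin) (auto simp: wcJ Yn le_p_def)
  then obtain g where g: "\<And>s j. s < f \<Longrightarrow> j \<in> J s \<Longrightarrow> dg Y j \<le> g s j \<and> g s j \<le> dg n j"
      "\<And>s. s < f \<Longrightarrow> sum (g s) (J s) = x s"
    by metis
  \<comment> \<open>\<open>c j\<close> is the only \<open>s < f\<close> for which position \<open>j\<close> wraps around.\<close>
  define c where "c j = f - 1 - j mod f" for j
  have cf: "c j < f" for j using f by (simp add: c_def)
  have jmod: "j mod f < f" for j using f by simp
  have Jc: "j \<in> J (c j)" if "j \<le> n" for j
  proof -
    have "(j + c j) mod f = (j mod f + c j) mod f" by (simp add: mod_add_left_eq)
    also have "j mod f + c j = f - 1" using jmod[of j] by (simp add: c_def)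
    finally show ?thesis using f that by (simp add: J_def)
  qed
  have c_eq: "c j = s" if "s < f" "j \<in> J s" for s j
  proof -
    have e: "(j mod f + s) mod f = f - 1"
      using that(2) unfolding J_def mod_add_left_eq by blast
    have "j mod f + s = f - 1"
    proof (cases "j mod f + s < f")
      case False
      then have "(j mod f + s) mod f = (j mod f + s - f) mod f"
        by (intro le_mod_geq) simp
      also have "\<dots> = j mod f + s - f"
        using jmod[of j] that(1) by (intro mod_less) linarith
      finally show ?thesis using e jmod[of j] that(1) by linarith
    qed (use e in simp)
    then show ?thesis by (simp add: c_def)
  qed
  define a where "a j = g (c j) j" for j
  define X where "X = (\<Sum>j<Suc n. a j * p ^ j)"
  have a: "dg Y j \<le> a j \<and> a j \<le> dg n j" if "j \<le> n" for j
    unfolding a_def by (rule g(1)[OF cf Jc[OF that]])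
  have dX: "dg X j = (if j < Suc n then a j else 0)" for j
    unfolding X_def
  proof (rule digit_of_sum)
    fix i assume "i < Suc n"
    then have "a i \<le> dg n i" using a by simp
    also have "\<dots> < p" using p by (intro digit_less) simp
    finally show "a i < p" .
  qed
  have Xn: "le_p p X n" using a by (auto simp: le_p_def dX)
  moreover have "le_p p Y X"
    using a digit_eq_0[OF p, of Y] Yn by (auto simp: le_p_def dX)
  moreover have "wc s X = x s" if "s < f" for s
  proof -
    have "wc s X = sum (dg X) (J s)" by (rule wcJ[OF le_p_imp_le[OF p Xn]])
    also have "\<dots> = sum (g s) (J s)"
      by (rule sum.cong) (auto simp: dX a_def c_eq[OF that] J_def[symmetric], simp add: J_def)
    finally show ?thesis using g(2)[OF that] by simp
  qed
  ultimately show ?thesis by blast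
qed

text \<open>The recurrence around the cycle has only one solution: the difference of two solutions is
  multiplied by \<open>p\<close> in each step, hence by \<open>p ^ f\<close> in a full turn, which also returns it to its
  initial value.\<close>

lemma weight_eqI:
  assumes u: "u f = u 0" "\<And>s. s < f \<Longrightarrow> p * u s = u (Suc s) + wc s X" and "s \<le> f"
  shows "wt s X = Q * u s"
proof -
  define \<delta> where "\<delta> s = int (wt s X) - int (Q * u s)" for s
  have step: "\<delta> (Suc s) = int p * \<delta> s" if "s < f" for s
  proof -
    have "p * (Q * u s) = Q * u (Suc s) + Q * wc s X"
      using u(2)[OF that] by (metis distrib_left mult.left_commute)
    then have "int p * int (Q * u s) = int (Q * u (Suc s)) + int (Q * wc s X)"
      by (metis of_nat_add of_nat_mult)
    moreover have "int p * int (wt s X) = int (wt (Suc s) X) + int (Q * wc s X)"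
      using weight_Suc[of s X] by (metis of_nat_add of_nat_mult)
    ultimately show ?thesis by (simp only: \<delta>_def right_diff_distrib)
  qed
  have pow: "s \<le> f \<Longrightarrow> \<delta> s = int p ^ s * \<delta> 0" for s
  proof (induction s)
    case (Suc s)
    then show ?case using step[of s] by simp
  qed simp
  have "wt f X = wt 0 X" using weight_mod[of f X] by simp
  then have "\<delta> f = \<delta> 0" by (simp add: \<delta>_def u(1))
  then have "(int p ^ f - 1) * \<delta> 0 = 0" using pow[of f] by (simp add: left_diff_distrib)
  moreover have "int p ^ f \<noteq> 1"
    using power_eq_Suc_Q Q_pos by (simp flip: of_nat_power)
  ultimately have "\<delta> 0 = 0" by simp
  then have "\<delta> s = 0" using pow[OF assms(3)] by simp
  then show ?thesis by (simp only: \<delta>_def eq_iff_diff_eq_0[symmetric] of_nat_eq_iff)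
qed

text \<open>With \<open>wt s n = Q * U s\<close>, a vector \<open>u\<close> with \<open>u f = u 0\<close> belongs to a suitable \<open>X\<close> as soon as
  \<open>p * u s - u (s + 1)\<close> lies between the wrap counts of \<open>Y\<close> and of \<open>n\<close>, and \<open>u s \<le> U s - k\<close>. The lower
  bound \<open>wt s Y \<le> Q * u s\<close> is carried along because it makes the differences non-negative.\<close>

lemma extend_to_multiple:
  assumes n: "Q dvd n" and Y: "le_p p Y n" and k: "\<And>s. Q * k \<le> wt s (n - Y)"
  shows "\<exists>X. le_p p Y X \<and> le_p p X n \<and> Q dvd X \<and> (\<forall>s. Q * k \<le> wt s (n - X))"
proof -
  define U where "U s = wt s n div Q" for s
  have QU: "wt s n = Q * U s" for s
    using dvd_weight[OF n, of s] by (simp add: U_def)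
  have YU: "wt s Y + Q * k \<le> Q * U s" for s
    using weight_diff[OF Y, of s] k[of s] QU[of s] by linarith
  have kU: "k \<le> U s" for s
  proof -
    have "Q * k \<le> Q * U s" using YU[of s] by linarith
    then show ?thesis using Q_pos by (simp only: mult_le_cancel1)
  qed
  have U_Suc: "p * U s = U (Suc s) + wc s n" for s
  proof -
    have "Q * (p * U s) = Q * (U (Suc s) + wc s n)"
      using weight_Suc[of s n] unfolding QU by (simp only: distrib_left mult.left_commute)
    then show ?thesis using Q_pos by (simp only: mult_cancel1) simp
  qed
  define B where "B s = U s - k" for s
  have YB: "wt s Y \<le> Q * B s" for s
    using YU[of s] by (simp add: B_def right_diff_distrib')
  have "U f = U 0" using weight_mod[of f n] by (simp add: U_def)
  then have Bf: "B f = B 0" by (simp add: B_def)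
  \<comment> \<open>The largest \<open>u (s + 1)\<close> that \<open>u s = z\<close> permits. It cannot make the wrap count of \<open>X\<close> exceed that
    of \<open>n\<close>, as \<open>U\<close> satisfies the recurrence for \<open>n\<close> and \<open>k \<le> p * k\<close>.\<close>
  define step where "step s z = min (B (Suc s)) (p * z - wc s Y)" for s z
  define path where "path z s = rec_nat z step s" for z s
  have path_0: "path z 0 = z" and path_Suc: "path z (Suc s) = step s (path z s)" for z s
    by (simp_all add: path_def)
  have path_mono: "z \<le> z' \<Longrightarrow> path z s \<le> path z' s" for z z' s
  proof (induction s)
    case (Suc s)
    then have "p * path z s \<le> p * path z' s" by simp
    then have "p * path z s - wc s Y \<le> p * path z' s - wc s Y" by (rule diff_le_mono)
    then show ?case unfolding path_Suc step_def by (intro min.mono order_refl)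
  qed (simp add: path_0)
  define adm where "adm s z \<longleftrightarrow> wt s Y \<le> Q * z \<and> z \<le> B s" for s z
  have adm_wc: "wt (Suc s) Y + Q * wc s Y \<le> Q * (p * z)" if "adm s z" for s z
  proof -
    have "p * wt s Y \<le> p * (Q * z)" using that by (simp add: adm_def)
    then show ?thesis unfolding weight_Suc by (simp only: mult.left_commute)
  qed
  have adm_step: "adm (Suc s) (step s z)" if "adm s z" for s z
  proof -
    have "wt (Suc s) Y \<le> Q * (p * z - wc s Y)"
      using adm_wc[OF that] unfolding diff_mult_distrib2 by linarith
    then show ?thesis using YB[of "Suc s"] by (auto simp: adm_def step_def min_def)
  qed
  have adm_path: "adm 0 z \<Longrightarrow> adm s (path z s)" for z s
    by (induction s) (simp_all add: path_0 path_Suc adm_step)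
  have "\<exists>z. adm 0 z \<and> path z f = z"
  proof (rule exists_fixed_point_le)
    show "mono (\<lambda>z. path z f)" by (rule monoI) (rule path_mono)
    show B0: "adm 0 (B 0)" by (simp add: adm_def YB)
    show "path (B 0) f \<le> B 0" using adm_path[OF B0, of f] by (simp add: adm_def Bf)
    show "adm 0 (path z f)" if "adm 0 z" for z
    proof -
      have "wt f Y = wt 0 Y" using weight_mod[of f Y] by simp
      then show ?thesis using adm_path[OF that, of f] by (simp add: adm_def Bf)
    qed
  qed
  then obtain z where z: "adm 0 z" "path z f = z" by blast
  define u where "u s = path z s" for s
  have u: "adm s (u s)" for s unfolding u_def by (rule adm_path[OF z(1)])
  have u_Suc: "u (Suc s) = step s (u s)" for s by (simp add: u_def path_Suc)
  have bounds: "u (Suc s) + wc s Y \<le> p * u s \<and> p * u s \<le> u (Suc s) + wc s n" for s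
  proof
    have "Q * wc s Y \<le> Q * (p * u s)" using adm_wc[OF u[of s]] by linarith
    then have Yu: "wc s Y \<le> p * u s" using Q_pos by (simp only: mult_le_cancel1)
    have "u (Suc s) \<le> p * u s - wc s Y" by (simp add: u_Suc step_def)
    then show "u (Suc s) + wc s Y \<le> p * u s" using Yu by linarith
    have "p * u s \<le> B (Suc s) + wc s n"
    proof -
      have "p * u s \<le> p * (U s - k)" using u[of s] by (simp add: adm_def B_def)
      also have "\<dots> = U (Suc s) + wc s n - p * k" by (simp add: diff_mult_distrib2 U_Suc)
      also have "\<dots> \<le> U (Suc s) + wc s n - k" using p by (intro diff_le_mono2) simp
      also have "\<dots> = B (Suc s) + wc s n" using kU[of "Suc s"] by (simp add: B_def)
      finally show ?thesis .
    qed
    then show "p * u s \<le> u (Suc s) + wc s n"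
      using wrap_count_mono[OF Y, of s] by (auto simp: u_Suc step_def min_def)
  qed
  obtain X where X: "le_p p Y X" "le_p p X n" "\<And>s. s < f \<Longrightarrow> wc s X = p * u s - u (Suc s)"
    using exists_with_wrap_counts[OF Y, of "\<lambda>s. p * u s - u (Suc s)"] bounds
    by (metis (no_types, lifting) le_diff_conv2 add.commute add_leD1 le_diff_conv)
  have wtX: "wt s X = Q * u s" if "s \<le> f" for s
  proof (rule weight_eqI[OF _ _ that])
    show "u f = u 0" using z(2) by (simp add: u_def path_0)
    show "p * u s = u (Suc s) + wc s X" if "s < f" for s
      using X(3)[OF that] bounds[of s] by linarith
  qed
  have "Q dvd wt 0 X" using wtX[of 0] by simp
  then have "Q dvd X" using dvd_iff_dvd_weight_0 by blast
  moreover have "Q * k \<le> wt s (n - X)" for s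
  proof -
    have "s mod f \<le> f" using f by (simp add: less_imp_le)
    then have "wt (s mod f) X = Q * u (s mod f)" by (rule wtX)
    moreover have "Q * (u (s mod f) + k) \<le> Q * U (s mod f)"
      using u[of "s mod f"] kU[of "s mod f"] unfolding adm_def B_def
      by (intro mult_le_mono2) linarith
    ultimately have "wt (s mod f) X + Q * k \<le> wt (s mod f) n"
      by (simp only: QU distrib_left)
    then show ?thesis using weight_diff[OF X(2), of s] by (simp add: weight_mod)
  qed
  ultimately show ?thesis using X(1,2) by blast
qed

section \<open>Compositions and the height\<close>

abbreviation composition where "composition \<equiv> is_composition p f"
abbreviation ht where "ht \<equiv> height p f"

lemma weight_sum_list: "no_carry p Xs \<Longrightarrow> wt s (sum_list Xs) = (\<Sum>X\<leftarrow>Xs. wt s X)"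
proof (induction Xs)
  case (Cons X Xs)
  have "le_p p X (X + sum_list Xs)"
    using le_p_sum_list_append(1)[OF p, of "[X]" Xs] Cons.prems by simp
  then have "wt s (X + sum_list Xs) = wt s X + wt s (sum_list Xs)"
    using weight_diff[of X "X + sum_list Xs" s] by simp
  moreover have "no_carry p Xs" using no_carry_append[of p "[X]" Xs] Cons.prems by simp
  ultimately show ?case using Cons.IH by simp
qed simp

lemma weight_composition:
  assumes "composition k n Xs"
  shows "Q * k \<le> wt s n"
proof -
  have "(\<Sum>X\<leftarrow>Xs. Q) \<le> (\<Sum>X\<leftarrow>Xs. wt s X)"
    using assms by (intro sum_list_mono Q_le_weight) (auto simp: is_composition_def Q_eq)
  then show ?thesis
    using assms weight_sum_list[of Xs s]
    by (auto simp: is_composition_def sum_list_triv mult.commute)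
qed

lemma composition_append_one:
  assumes "le_p p X n" "Q dvd X" "0 < X" "composition k (n - X) Ys"
  shows "composition (Suc k) n (Ys @ [X])"
proof -
  have nc: "no_carry p Ys" and sum: "sum_list Ys = n - X"
    using assms(4) by (auto simp: is_composition_def)
  have "(\<Sum>Y\<leftarrow>Ys. dg Y j) + dg X j = dg n j" for j
  proof -
    have "dg X j \<le> dg n j" using assms(1) by (simp add: le_p_def)
    then show ?thesis
      using digit_sum_list[OF p nc, of j] digit_diff[OF p assms(1), of j] by (simp add: sum)
  qed
  then have "no_carry p (Ys @ [X])"
    using p by (simp add: no_carry_def digit_less)
  then show ?thesis
    using assms le_p_imp_le[OF p assms(1)] by (auto simp: is_composition_def Q_eq)
qed

lemma composition_remove_last:
  assumes "composition (Suc k) n (Ys @ [X])"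
  shows "le_p p X n \<and> composition k (n - X) Ys"
  using assms le_p_sum_list_append(2)[OF p, of Ys "[X]"] no_carry_append[of p Ys "[X]"]
  by (auto simp: is_composition_def)

text \<open>A single part has weight at most \<open>p ^ (f - 1) \<le> q - 1\<close> in each rotation.\<close>

lemma weight_remove_power:
  assumes "0 < dg n j"
  shows "le_p p (p ^ j) n" and "wt s n \<le> wt s (n - p ^ j) + Q"
proof -
  show *: "le_p p (p ^ j) n"
    using assms by (simp add: le_p_def digit_base_power[OF p])
  show "wt s n \<le> wt s (n - p ^ j) + Q"
    using weight_diff[OF *, of s] weight_power_le[of s j] by linarith
qed

text \<open>Removing one part lowers each weight by at most \<open>Q\<close>. The extension lemma enlarges the removed
  part to a multiple of \<open>Q\<close>, which becomes an entry, and the rest is decomposed by induction.\<close>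

lemma exists_composition:
  assumes "0 < k" "Q dvd n" "0 < n" "\<And>s. Q * k \<le> wt s n"
  shows "\<exists>Xs. composition k n Xs"
  using assms
proof (induction k arbitrary: n rule: nat_induct_non_zero)
  case 1
  have "composition 1 n [n]"
    using 1 p by (simp add: is_composition_def no_carry_def digit_less Q_eq)
  then show ?case by blast
next
  case (Suc k)
  obtain j where j: "0 < dg n j" using exists_digit_pos[OF p] Suc.prems(2) by blast
  have "Q * k \<le> wt s (n - p ^ j)" for s
    using weight_remove_power(2)[OF j, of s] Suc.prems(3)[of s] by simp
  then obtain X where X: "le_p p (p ^ j) X" "le_p p X n" "Q dvd X" "\<And>s. Q * k \<le> wt s (n - X)"
    using extend_to_multiple[OF Suc.prems(1) weight_remove_power(1)[OF j]] by blast
  have "0 < p ^ j" using p by simp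
  then have X0: "0 < X" using le_p_imp_le[OF p X(1)] by linarith
  have "0 < Q * k" using Q_pos Suc.hyps by simp
  then have "wt 0 (n - X) \<noteq> 0" using X(4)[of 0] by linarith
  then have "0 < n - X" by (simp add: weight_eq_0_iff)
  moreover have "Q dvd n - X" using Suc.prems(1) X(3) by simp
  ultimately obtain Ys where "composition k (n - X) Ys" using Suc.IH X(4) by blast
  then show ?case using composition_append_one[OF X(2,3) X0] by blast
qed

text \<open>Each step of a chain adds a positive multiple of \<open>Q\<close>, all of whose rotated weights are positive
  multiples of \<open>Q\<close> as well.\<close>

lemma weight_chain:
  assumes c: "c 0 = 0" "inj_on c {..h}" "\<forall>i<h. prec p f (c i) (c (Suc i))"
  shows "i \<le> h \<Longrightarrow> Q dvd c i \<and> (\<forall>s. Q * i \<le> wt s (c i))"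
proof (induction i)
  case (Suc i)
  then have IH: "Q dvd c i" "\<And>s. Q * i \<le> wt s (c i)" by auto
  have le: "le_p p (c i) (c (Suc i))" and cong: "[c i = c (Suc i)] (mod Q)"
    using c(3) Suc.prems by (auto simp: prec_def Q_eq)
  have dvd: "Q dvd c (Suc i)" using IH(1) cong by (metis cong_dvd_iff)
  have "c i \<noteq> c (Suc i)" using inj_onD[OF c(2), of i "Suc i"] Suc.prems by auto
  then have "0 < c (Suc i) - c i" using le_p_imp_le[OF p le] by simp
  moreover have "Q dvd c (Suc i) - c i" using dvd IH(1) by simp
  ultimately have gap: "Q \<le> wt s (c (Suc i) - c i)" for s by (intro Q_le_weight)
  then have "Q * Suc i \<le> wt s (c (Suc i))" for s
    using IH(2)[of s] gap[of s] weight_diff[OF le, of s] unfolding mult_Suc_right by linarith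
  then show ?case using dvd by blast
qed (simp add: c(1))

lemma composition_imp_chain:
  assumes "composition k n Xs"
  shows "\<exists>c. c 0 = 0 \<and> inj_on c {..k} \<and> (\<forall>i<k. prec p f (c i) (c (Suc i))) \<and> le_p p (c k) n"
proof -
  define c where "c i = sum_list (take i Xs)" for i
  have Xs: "length Xs = k" "\<And>X. X \<in> set Xs \<Longrightarrow> 0 < X \<and> Q dvd X" "sum_list Xs = n" "no_carry p Xs"
    using assms by (auto simp: is_composition_def Q_eq)
  have take_Suc: "take (Suc i) Xs = take i Xs @ [Xs ! i]" if "i < k" for i
    using that Xs(1) by (simp add: take_Suc_conv_app_nth)
  have c_Suc: "c (Suc i) = c i + Xs ! i" "0 < Xs ! i" "Q dvd Xs ! i" if "i < k" for i
    using take_Suc[OF that] Xs(2)[of "Xs ! i"] Xs(1) that by (auto simp: c_def)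
  have "prec p f (c i) (c (Suc i))" if "i < k" for i
  proof -
    have "no_carry p (take (Suc i) Xs)"
      using no_carry_append[of p "take (Suc i) Xs" "drop (Suc i) Xs"] Xs(4) by simp
    then have "le_p p (c i) (c (Suc i))"
      using le_p_sum_list_append(1)[OF p, of "take i Xs" "[Xs ! i]"]
      by (simp only: c_def take_Suc[OF that])
    moreover have "[c i = c (Suc i)] (mod Q)"
      using c_Suc[OF that] by (auto simp: cong_def elim!: dvdE)
    ultimately show ?thesis by (simp add: prec_def Q_eq)
  qed
  moreover have "inj_on c {..k}"
  proof (rule strict_mono_on_imp_inj_on)
    have *: "i < j \<Longrightarrow> j \<le> k \<Longrightarrow> c i < c j" for i j
    proof (induction j)
      case (Suc j)
      then have "c i \<le> c j" by (cases "i = j") (auto simp: less_imp_le)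
      then show ?case using c_Suc[of j] Suc.prems(2) by simp
    qed simp
    then show "strict_mono_on {..k} c" by (auto intro!: strict_mono_onI)
  qed
  moreover have "c k = n" using Xs(1,3) by (simp add: c_def)
  ultimately show ?thesis by (intro exI[of _ c]) (auto simp: c_def)
qed

text \<open>The rotation in which \<open>n\<close> has its minimal weight bounds the length of every chain, and the
  partial sums of a composition form a chain of this length.\<close>

theorem Q_mult_height:
  assumes n: "Q dvd n" "0 < n"
  shows "Q * ht n = I n" and "0 < ht n"
proof -
  obtain s where s: "I n = wt s n" using indicator_attained by blast
  then obtain k where k: "I n = Q * k" using dvd_weight[OF n(1), of s] by auto
  have "0 < I n" using weight_eq_0_iff[of s n] n(2) s by simp
  then have k0: "0 < k" using k by simp
  have "ht n = k"
    unfolding height_def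
  proof (rule Max_eqI)
    let ?H = "{h. \<exists>c. c 0 = 0 \<and> inj_on c {..h} \<and> (\<forall>i<h. prec p f (c i) (c (Suc i))) \<and> le_p p (c h) n}"
    have le_k: "h \<le> k" if "h \<in> ?H" for h
    proof -
      obtain c where c: "c 0 = 0" "inj_on c {..h}" "\<forall>i<h. prec p f (c i) (c (Suc i))" "le_p p (c h) n"
        using \<open>h \<in> ?H\<close> by blast
      have "Q * h \<le> wt s (c h)" using weight_chain[OF c(1-3) order_refl] by blast
      also have "\<dots> \<le> Q * k" using weight_mono[OF c(4), of s] s k by simp
      finally show ?thesis using Q_pos by simp
    qed
    then show "finite ?H" by (meson finite_nat_set_iff_bounded_le)
    show "h \<le> k" if "h \<in> ?H" for h by (rule le_k[OF that])
    have "Q * k \<le> wt s n" for s using indicator_le_weight[of n s] k by simp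
    then show "k \<in> ?H"
      using exists_composition[OF k0 n] composition_imp_chain by blast
  qed
  then show "Q * ht n = I n" "0 < ht n" using k k0 by simp_all
qed

section \<open>The largest feasible subnumber\<close>

text \<open>The set of selections \<open>Y\<close> that the test in step (2) of the algorithm admits.\<close>

definition feasible :: "nat \<Rightarrow> nat \<Rightarrow> bool" where
  "feasible n Y \<longleftrightarrow> le_p p Y n \<and> Q * (ht n - 1) \<le> I (n - Y)"

definition top_part :: "nat \<Rightarrow> nat" where
  "top_part n = Max {Y. feasible n Y}"

lemma feasible_mono:
  assumes "le_p p Y Z" "feasible n Z"
  shows "feasible n Y"
proof -
  have Z: "le_p p Z n" "\<And>s. Q * (ht n - 1) \<le> wt s (n - Z)"
    using assms(2) by (auto simp: feasible_def le_indicator_iff)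
  have "wt s (n - Z) \<le> wt s (n - Y)" for s
    by (rule weight_mono[OF le_p_antimono_diff[OF p assms(1) Z(1)]])
  then show ?thesis
    using Z(2) le_p_trans[OF assms(1) Z(1)] by (auto simp: feasible_def le_indicator_iff intro: order_trans)
qed

context
  fixes n :: nat
  assumes n_dvd: "Q dvd n" and n_pos: "0 < n"
begin

lemma weight_eq_indicator_0: "I n = Q * Suc (ht n - 1)"
  using Q_mult_height[OF n_dvd n_pos] by simp

lemma finite_feasible: "finite {Y. feasible n Y}"
  by (rule finite_subset[of _ "{..n}"]) (auto simp: feasible_def dest: le_p_imp_le[OF p])

lemma feasible_power: "0 < dg n j \<Longrightarrow> feasible n (p ^ j)"
proof -
  assume j: "0 < dg n j"
  have "Q * (ht n - 1) \<le> wt s (n - p ^ j)" for s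
    using weight_remove_power(2)[OF j, of s] indicator_le_weight[of n s]
    by (simp add: weight_eq_indicator_0)
  then show ?thesis
    using weight_remove_power(1)[OF j] by (simp add: feasible_def le_indicator_iff)
qed

lemma le_top_part: "feasible n Y \<Longrightarrow> Y \<le> top_part n"
  unfolding top_part_def by (rule Max_ge[OF finite_feasible]) simp

lemma feasible_top_part: "feasible n (top_part n)"
proof -
  obtain j where "0 < dg n j" using exists_digit_pos[OF p n_pos] by blast
  then have "{Y. feasible n Y} \<noteq> {}" using feasible_power by blast
  then show ?thesis unfolding top_part_def using Max_in[OF finite_feasible] by blast
qed

lemma top_part_le_p: "le_p p (top_part n) n"
  using feasible_top_part by (simp add: feasible_def)

lemma top_part_pos: "0 < top_part n"
proof -
  obtain j where "0 < dg n j" using exists_digit_pos[OF p n_pos] by blast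
  then have "p ^ j \<le> top_part n" by (intro le_top_part feasible_power)
  moreover have "0 < p ^ j" using p by simp
  ultimately show ?thesis by linarith
qed

text \<open>An extension of the largest feasible number to a multiple of \<open>Q\<close> is again feasible, so it is not
  a proper one.\<close>

lemma top_part_dvd: "Q dvd top_part n"
proof -
  have "\<And>s. Q * (ht n - 1) \<le> wt s (n - top_part n)"
    using feasible_top_part by (simp add: feasible_def le_indicator_iff)
  then obtain X where X: "le_p p (top_part n) X" "le_p p X n" "Q dvd X"
      "\<forall>s. Q * (ht n - 1) \<le> wt s (n - X)"
    using extend_to_multiple[OF n_dvd top_part_le_p] by blast
  then have "X \<le> top_part n" by (intro le_top_part) (simp add: feasible_def le_indicator_iff)
  then have "X = top_part n" using le_p_imp_le[OF p X(1)] by simp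
  then show ?thesis using X(3) by simp
qed

text \<open>In a rotation where \<open>n\<close> attains its minimum \<open>Q * ht n\<close>, the complement of \<open>top_part n\<close> takes at least
  \<open>Q * (ht n - 1)\<close>.\<close>

lemma top_part_weight: "\<exists>s. wt s (top_part n) \<le> Q"
proof -
  obtain s where s: "I n = wt s n" using indicator_attained by blast
  have "Q * (ht n - 1) \<le> wt s (n - top_part n)"
    using feasible_top_part by (simp add: feasible_def le_indicator_iff)
  then have "wt s (top_part n) \<le> Q"
    using weight_diff[OF top_part_le_p, of s] s weight_eq_indicator_0 by simp
  then show ?thesis by blast
qed

lemma indicator_top_part: "I (top_part n) = Q"
proof (rule antisym)
  obtain s where "wt s (top_part n) \<le> Q" using top_part_weight by blast
  then show "I (top_part n) \<le> Q" using indicator_le_weight order_trans by blast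
  show "Q \<le> I (top_part n)"
    unfolding le_indicator_iff using Q_le_weight[OF top_part_dvd top_part_pos] by blast
qed

text \<open>In the rotation of \<open>top_part_weight\<close> such an \<open>m\<close> exhausts the whole weight of \<open>top_part n\<close>, while
  every part has positive weight. This is why the algorithm does not stop too early.\<close>

lemma eq_top_part_if_indicator_ge:
  assumes "le_p p m (top_part n)" "Q \<le> I m"
  shows "m = top_part n"
proof -
  obtain s where "wt s (top_part n) \<le> Q" using top_part_weight by blast
  also have "Q \<le> wt s m" using assms(2) by (simp add: le_indicator_iff)
  finally show ?thesis by (rule eq_if_le_p_if_weight_eq[OF assms(1)])
qed

lemma composition_with_top_part: "\<exists>Ys. composition (ht n) n (Ys @ [top_part n])"
proof -
  let ?G = "top_part n" and ?k = "ht n - 1"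
  have ht: "ht n = Suc ?k" using Q_mult_height(2)[OF n_dvd n_pos] by simp
  have wt: "\<And>s. Q * ?k \<le> wt s (n - ?G)"
    using feasible_top_part by (simp add: feasible_def le_indicator_iff)
  have "\<exists>Ys. composition ?k (n - ?G) Ys"
  proof (cases "?k = 0")
    case True
    \<comment> \<open>For height \<open>1\<close> every subnumber is feasible, so nothing is left besides \<open>top_part n = n\<close>.\<close>
    then have "n \<le> ?G" by (intro le_top_part) (simp add: feasible_def)
    then show ?thesis
      using p unfolding True by (intro exI[of _ "[]"]) (simp add: is_composition_def no_carry_def)
  next
    case False
    then have "0 < Q * ?k" using Q_pos by simp
    then have "wt 0 (n - ?G) \<noteq> 0" using wt[of 0] by linarith
    then have "0 < n - ?G" by (simp add: weight_eq_0_iff)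
    moreover have "Q dvd n - ?G" using n_dvd top_part_dvd by simp
    moreover have "0 < ?k" using False by simp
    ultimately show ?thesis using exists_composition wt by blast
  qed
  then have "\<exists>Ys. composition (Suc ?k) n (Ys @ [?G])"
    using composition_append_one[OF top_part_le_p top_part_dvd top_part_pos] by blast
  then show ?thesis by (simp only: ht[symmetric])
qed

text \<open>The other entries form a composition of \<open>n - X\<close>, whose length forces \<open>X\<close> to be feasible.\<close>

lemma composition_last_le:
  assumes "composition (ht n) n (Ys @ [X])"
  shows "X \<le> top_part n"
proof -
  have ht: "ht n = Suc (ht n - 1)" using Q_mult_height(2)[OF n_dvd n_pos] by simp
  have "le_p p X n \<and> composition (ht n - 1) (n - X) Ys"
    by (rule composition_remove_last) (simp only: ht[symmetric] assms)
  then show ?thesis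
    using weight_composition by (intro le_top_part) (auto simp: feasible_def le_indicator_iff)
qed

text \<open>The lexicographic order on reversed lists compares last entries first, so the last entry of the
  greatest composition is the greatest last entry of any composition.\<close>

lemma last_Sh: "Sh p f n ! (ht n - 1) = top_part n"
proof -
  let ?C = "{Xs. composition (ht n) n Xs}"
  define r where "r = {(Ys, Xs). (rev Ys, rev Xs) \<in> lexord (less_than :: (nat \<times> nat) set)}"
  have len: "length Xs = ht n" if "Xs \<in> ?C" for Xs
    using that by (simp add: is_composition_def)
  have "?C \<subseteq> {Xs. set Xs \<subseteq> {..n} \<and> length Xs = ht n}"
    by (auto simp: is_composition_def intro: member_le_sum_list)
  then have fin: "finite ?C" by (rule finite_subset) (simp add: finite_lists_length_eq)
  have r_trans: "trans r"
    unfolding r_def trans_def using lexord_trans[of _ _ less_than] by (auto simp: trans_less_than)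
  have r_irrefl: "(Xs, Xs) \<notin> r" for Xs
    by (simp add: r_def lexord_irreflexive)
  have r_total: "Xs = Ys \<or> (Xs, Ys) \<in> r \<or> (Ys, Xs) \<in> r" for Xs Ys
  proof -
    have "\<forall>a b. (a, b) \<in> less_than \<or> a = b \<or> (b, a) \<in> less_than"
      by (simp add: less_than_iff) (meson linorder_less_linear)
    from lexord_linear[OF this, of "rev Xs" "rev Ys"] show ?thesis unfolding r_def by auto
  qed
  obtain Ys where Ys: "Ys @ [top_part n] \<in> ?C" using composition_with_top_part by blast
  obtain Xs where Xs: "Xs \<in> ?C" "\<forall>Zs\<in>?C. Zs = Xs \<or> (Zs, Xs) \<in> r"
    using exists_greatest_of_finite[OF fin _ r_trans r_total] Ys by blast
  have "Sh p f n = Xs"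
    unfolding Sh_def
  proof (rule the_equality)
    show "composition (ht n) n Xs \<and> (\<forall>Ys. composition (ht n) n Ys \<longrightarrow>
        Ys = Xs \<or> (rev Ys, rev Xs) \<in> lexord less_than)"
      using Xs by (simp add: r_def)
    fix Zs
    assume "composition (ht n) n Zs \<and> (\<forall>Ys. composition (ht n) n Ys \<longrightarrow>
        Ys = Zs \<or> (rev Ys, rev Zs) \<in> lexord less_than)"
    then have "Zs \<in> ?C" "Xs = Zs \<or> (Xs, Zs) \<in> r" using Xs(1) by (auto simp: r_def)
    then show "Zs = Xs" using Xs(2) r_irrefl transD[OF r_trans] by blast
  qed
  moreover have "last Xs = top_part n"
  proof (rule antisym)
    have "0 < length Xs" using len[OF Xs(1)] Q_mult_height(2)[OF n_dvd n_pos] by simp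
    then have ne: "Xs \<noteq> []" by simp
    then show "last Xs \<le> top_part n"
      using Xs(1) by (intro composition_last_le[of "butlast Xs"]) simp
    obtain Zs x where Zs: "Xs = Zs @ [x]" using ne by (metis append_butlast_last_id)
    have "Ys @ [top_part n] = Xs \<or> (Ys @ [top_part n], Xs) \<in> r" using Xs(2) Ys by blast
    then show "top_part n \<le> last Xs" by (auto simp: Zs r_def)
  qed
  moreover have "Xs \<noteq> []" using len[OF Xs(1)] Q_mult_height(2)[OF n_dvd n_pos] by auto
  ultimately show ?thesis using len[OF Xs(1)] by (simp add: last_conv_nth)
qed

section \<open>The greedy algorithm\<close>

abbreviation ds where "ds \<equiv> p_parts p n"

definition remaining :: "nat \<Rightarrow> nat \<Rightarrow> nat" where
  "remaining \<nu> j = count_list (drop \<nu> ds) (p ^ j)"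

text \<open>After \<open>\<nu>\<close> parts have been examined, the selection \<open>m\<close> lies inside \<open>top_part n\<close>, and the parts of
  \<open>top_part n\<close> still missing are among the remaining ones. The last inequality says that \<open>m\<close> consists of
  examined parts, so that the next part can be added without a carry and the result stays below \<open>n\<close>.\<close>

fun greedy_inv :: "nat \<times> nat \<times> nat \<Rightarrow> bool" where
  "greedy_inv (\<nu>, m, m') \<longleftrightarrow> \<nu> \<le> length ds \<and> m' = n - m \<and>
     (\<forall>j. dg m j \<le> dg (top_part n) j \<and> dg (top_part n) j \<le> dg m j + remaining \<nu> j \<and>
          dg m j + remaining \<nu> j \<le> dg n j)"

lemma greedy_inv_init: "greedy_inv (0, 0, n)"
  using top_part_le_p p_parts_count[OF p, of n] by (simp add: remaining_def le_p_def)

lemma greedy_inv_continue: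
  assumes "greedy_inv (\<nu>, m, m')" "I m < Q"
  shows "\<nu> < length ds"
proof (rule ccontr)
  assume "\<not> ?thesis"
  then have "remaining \<nu> j = 0" for j by (simp add: remaining_def)
  then have "dg m j = dg (top_part n) j" for j using assms(1) by (simp add: order_antisym)
  then have "m = top_part n" by (rule digit_eqI[OF p])
  then show False using assms(2) indicator_top_part by simp
qed

lemma greedy_inv_stop:
  assumes "greedy_inv (\<nu>, m, m')" "\<not> I m < Q"
  shows "m = top_part n"
  using assms by (intro eq_top_part_if_indicator_ge) (auto simp: le_p_def)

text \<open>If \<open>top_part n\<close> still needs the part \<open>p ^ j\<close>, the enlarged selection lies inside \<open>top_part n\<close> and is
  feasible. If not, then \<open>m\<close> and \<open>top_part n\<close> agree from position \<open>j\<close> on, because all larger parts have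
  been examined; accepting \<open>p ^ j\<close> would exceed \<open>top_part n\<close> and is therefore infeasible.\<close>

lemma greedy_inv_step:
  assumes inv: "greedy_inv (\<nu>, m, m')" and less: "\<nu> < length ds"
  shows "greedy_inv (alg_step2 p f n (Suc \<nu>, m, m'))"
    and "fst (alg_step2 p f n (Suc \<nu>, m, m')) = Suc \<nu>"
proof -
  let ?G = "top_part n"
  have inv': "m' = n - m" "\<And>j. dg m j \<le> dg ?G j" "\<And>j. dg ?G j \<le> dg m j + remaining \<nu> j"
      "\<And>j. dg m j + remaining \<nu> j \<le> dg n j"
    using inv by auto
  have "ds ! \<nu> \<in> set ds" using less by simp
  then obtain j where j: "ds ! \<nu> = p ^ j" using p_parts_power by blast
  have rem_Suc: "remaining \<nu> i = remaining (Suc \<nu>) i + (if i = j then 1 else 0)" for i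
    using less p by (simp add: remaining_def j flip: Cons_nth_drop_Suc)
  have rem_0: "remaining \<nu> i = 0" if "j < i" for i
  proof -
    have "p ^ i \<notin> set (drop \<nu> ds)"
    proof
      assume "p ^ i \<in> set (drop \<nu> ds)"
      then obtain k where k: "k < length ds - \<nu>" "ds ! (\<nu> + k) = p ^ i"
        by (auto simp: in_set_conv_nth)
      have "ds ! (\<nu> + k) \<le> ds ! \<nu>"
        using sorted_wrt_nth_less[OF p_parts_sorted[OF p, of n], of \<nu> "\<nu> + k"] k(1)
        by (cases "k = 0") auto
      moreover have "p ^ j < p ^ i" using that p by (simp add: power_strict_increasing)
      ultimately show False using k(2) j by simp
    qed
    then show ?thesis by (simp add: remaining_def count_list_0_iff)
  qed
  have le_mn: "le_p p m n" using inv'(4) add_leD1 unfolding le_p_def by blast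
  have less_n: "dg m j < dg n j" using inv'(4)[of j] rem_Suc[of j] by simp
  have digits: "dg (m + p ^ j) i = dg m i + (if i = j then 1 else 0)" for i
    by (rule le_p_add_power(1)[OF p le_mn less_n])
  have add_le: "le_p p (m + p ^ j) n" by (rule le_p_add_power(2)[OF p le_mn less_n])
  have test: "Q * (ht n - 1) \<le> I (m' - p ^ j) \<longleftrightarrow> feasible n (m + p ^ j)"
    using add_le by (simp add: feasible_def inv'(1))
  have step: "alg_step2 p f n (Suc \<nu>, m, m')
      = (if feasible n (m + p ^ j) then (Suc \<nu>, m + p ^ j, m' - p ^ j) else (Suc \<nu>, m, m'))"
    unfolding test[symmetric] by (simp add: alg_step2_def j Q_eq Let_def)
  show "fst (alg_step2 p f n (Suc \<nu>, m, m')) = Suc \<nu>" by (simp add: step)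
  show "greedy_inv (alg_step2 p f n (Suc \<nu>, m, m'))"
  proof (cases "dg m j < dg ?G j")
    case True
    have "le_p p m ?G" using inv'(2) by (simp add: le_p_def)
    then have "le_p p (m + p ^ j) ?G" using True by (rule le_p_add_power(2)[OF p])
    then have feas: "feasible n (m + p ^ j)" using feasible_top_part by (rule feasible_mono)
    have "dg (m + p ^ j) i \<le> dg ?G i \<and> dg ?G i \<le> dg (m + p ^ j) i + remaining (Suc \<nu>) i \<and>
        dg (m + p ^ j) i + remaining (Suc \<nu>) i \<le> dg n i" for i
      using inv'(2-4)[of i] rem_Suc[of i] True unfolding digits by (cases "i = j") simp_all
    then show ?thesis unfolding step using less feas by (simp add: inv'(1))
  next
    case False
    then have eq_j: "dg m j = dg ?G j" using inv'(2)[of j] by simp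
    have "dg m i = dg ?G i" if "j \<le> i" for i
      using that eq_j rem_0[of i] inv'(2,3)[of i] by (cases "i = j") auto
    then have "?G < m + p ^ j" by (rule less_add_power_if_digits_agree[OF p])
    then have infeas: "\<not> feasible n (m + p ^ j)" using le_top_part leD by blast
    have "dg m i \<le> dg ?G i \<and> dg ?G i \<le> dg m i + remaining (Suc \<nu>) i \<and>
        dg m i + remaining (Suc \<nu>) i \<le> dg n i" for i
      using inv'(2-4)[of i] rem_Suc[of i] eq_j by (cases "i = j") simp_all
    then show ?thesis unfolding step using less infeas by (simp add: inv'(1))
  qed
qed

theorem Alg_eq_top_part:
  "\<exists>\<nu>. Alg p f n = Some (\<nu>, top_part n, n - top_part n) \<and> \<nu> \<le> digit_sum p n"
proof -
  let ?b = "\<lambda>(\<nu>, m, m'). I m < Q"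
  let ?c = "\<lambda>(\<nu>, m, m'). alg_step2 p f n (\<nu> + 1, m, m')"
  have step: "greedy_inv (?c st) \<and> length ds - fst (?c st) < length ds - fst st"
    if inv: "greedy_inv st" and b: "?b st" for st
  proof -
    obtain \<nu> m m' where st: "st = (\<nu>, m, m')" by (cases st)
    have "\<nu> < length ds" using greedy_inv_continue[of \<nu> m m'] inv b by (simp add: st)
    then show ?thesis using greedy_inv_step[of \<nu> m m'] inv by (simp add: st)
  qed
  \<comment> \<open>The first execution of step (2), before any test, is a loop iteration from \<open>(0, 0, n)\<close>, where the
    loop condition holds.\<close>
  have "I 0 < Q" using indicator_le_weight[of 0 0] Q_pos by simp
  then have init: "greedy_inv (?c (0, 0, n))" using step[OF greedy_inv_init] by simp
  obtain st where st: "while_option ?b ?c (?c (0, 0, n)) = Some st"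
    using measure_while_option_Some[of greedy_inv ?b ?c "\<lambda>st. length ds - fst st", OF step init]
    by blast
  have inv: "greedy_inv st"
    by (rule while_option_rule[where P = greedy_inv and b = ?b and c = ?c, OF _ st init]) (use step in blast)
  obtain \<nu> m m' where st_eq: "st = (\<nu>, m, m')" by (cases st)
  have "m = top_part n"
    using greedy_inv_stop[of \<nu> m m'] inv while_option_stop[OF st] by (simp add: st_eq)
  moreover have "m' = n - m" "\<nu> \<le> digit_sum p n"
    using inv p_parts_length[of p n] by (simp_all add: st_eq)
  moreover have "Alg p f n = Some st" using st by (simp add: Alg_def Q_eq)
  ultimately show ?thesis by (simp add: st_eq)
qed

end

end

theorem theorem4p6:
  fixes p f n :: nat
  assumes "prime p" and "f \<ge> 1" and "n \<ge> 1" and "p ^ f - 1 dvd n"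
  shows "\<exists>\<nu> m m'. Alg p f n = Some (\<nu>, m, m') \<and>
           \<nu> \<le> digit_sum p n \<and>
           indicator_I p f m = p ^ f - 1 \<and>
           m = Sh p f n ! (height p f n - 1) \<and>
           m' = n - Sh p f n ! (height p f n - 1)"
proof -
  interpret base_and_period p f "p ^ f - 1"
    using assms(1,2) by unfold_locales (auto simp: prime_ge_2_nat)
  have n: "p ^ f - 1 dvd n" "0 < n" using assms(3,4) by auto
  show ?thesis
    using Alg_eq_top_part[OF n] indicator_top_part[OF n] unfolding last_Sh[OF n] by blast
qed

end
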